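(* Let $d\ge2$, $1\le r\le d$, let $\mathbb{L}\in\mathbb{R}^{d\times d}$ be symmetric with $\mathbb{L}\succeq0$ and $L:=\|\mathbb{L}\|>0$, and put $r_{\mathrm{eff}}:=\operatorname{tr}(\mathbb{L})/L$, $\delta_{\mathrm{diag}}:=\|\operatorname{diag}(\mathbb{L})\|/L$, and $\beta:=\dfrac{d(d-r)}{(d+2)(d-1)}$. Then the sketch moment conditions $$\mathbb{E}[PP^\top]=I_d,\qquad \mathbb{E}[(PP^\top)^2]\preceq\omega I_d,\qquad \mathbb{E}[PP^\top\mathbb{L}PP^\top]\preceq\ell L\,I_d$$ hold for each of the following random matrices $P\in\mathbb{R}^{d\times r}$ with the indicated constants: (Haar) $P=\sqrt{d/r}\,R$, where $R$ consists of the first $r$ columns of a Haar-distributed orthogonal $d\times d$ matrix: $\omega=\dfrac dr$, $\ell=\dfrac dr\Big(1-\beta+\beta\dfrac{r_{\mathrm{eff}}}{d}\Big)$, so that $\sqrt{\omega\ell r^2}=d\sqrt{1-\beta+\beta\, r_{\mathrm{eff}}/d}$. (Coordinate) $P=\sqrt{d/r}\,S$, where $S$ consists of $r$ uniformly sampled distinct columns of $I_d$: $\omega=\dfrac dr$, $\ell=\dfrac dr\Big(\dfrac{r-1}{d-1}+\dfrac{d-r}{d-1}\delta_{\mathrm{diag}}\Big)$, so that $\sqrt{\omega\ell r^2}=d\sqrt{\tfrac{r-1}{d-1}+\tfrac{d-r}{d-1}\delta_{\mathrm{diag}}}$. (Gaussian) $P_{ij}\sim\mathcal N(0,1/r)$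 i.i.d.: $\omega=\dfrac{d+r+1}{r}$, $\ell=\dfrac{r+1+r_{\mathrm{eff}}}{r}$, so that $\sqrt{\omega\ell r^2}=\sqrt{(d+r+1)(r+1+r_{\mathrm{eff}})}$. Moreover, $$1\le r_{\mathrm{eff}}\le d,\qquad \frac1d\le\delta_{\mathrm{diag}}\le1,\qquad \delta_{\mathrm{diag}}\ge\frac{r_{\mathrm{eff}}}{d}.$$
   Context: $\|\cdot\|$ on matrices is the operator norm induced by the Euclidean norm; $A\preceq B$ means $B-A$ is positive semidefinite; $\operatorname{diag}(A)$ is the diagonal matrix with the same diagonal entries as $A$. *)

theory Defs
  imports "HOL-Probability.Probability"
begin

text \<open>A \<open>d \<times> r\<close> real matrix is a value of type \<open>real^'r^'d\<close> with \<open>d = CARD('d)\<close>, \<open>r = CARD('r)\<close>.\<close>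

text \<open>\<^const>\<open>norm\<close> on \<open>real^'n^'m\<close> is the Frobenius norm, so the operator norm needs its own name.\<close>

definition opnorm :: "real^'n^'m \<Rightarrow> real" where
  "opnorm A = onorm (\<lambda>x. A *v x)"

definition pos_semidef :: "real^'n^'n \<Rightarrow> bool" where
  "pos_semidef A \<longleftrightarrow> transpose A = A \<and> (\<forall>x. 0 \<le> x \<bullet> (A *v x))"

definition loewner_le :: "real^'n^'n \<Rightarrow> real^'n^'n \<Rightarrow> bool" (infix \<open>\<preceq>\<^sub>L\<close> 50) where
  "A \<preceq>\<^sub>L B \<longleftrightarrow> pos_semidef (B - A)"

definition diag_part :: "real^'n^'n \<Rightarrow> real^'n^'n" where
  "diag_part A = (\<chi> i j. if i = j then A $ i $ j else 0)"

definition select_columns :: "('r \<Rightarrow> 'n) \<Rightarrow> real^'n^'m \<Rightarrow> real^'r^'m" where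
  "select_columns c A = (\<chi> i j. A $ i $ c j)"

text \<open>The Bochner integral of a non-integrable function is 0 by convention, so the existence of
  the three expectations is stated explicitly.\<close>

definition sketch_moment_conditions ::
  "'w measure \<Rightarrow> ('w \<Rightarrow> real^'r^'d) \<Rightarrow> real^'d^'d \<Rightarrow> real \<Rightarrow> real \<Rightarrow> bool" where
  "sketch_moment_conditions M P LL om l \<longleftrightarrow>
     integrable M (\<lambda>w. P w ** transpose (P w)) \<and>
     integrable M (\<lambda>w. (P w ** transpose (P w)) ** (P w ** transpose (P w))) \<and>
     integrable M (\<lambda>w. P w ** transpose (P w) ** LL ** P w ** transpose (P w)) \<and>
     (\<integral>w. P w ** transpose (P w) \<partial>M) = mat 1 \<and>
     (\<integral>w. (P w ** transpose (P w)) ** (P w ** transpose (P w)) \<partial>M) \<preceq>\<^sub>L om *\<^sub>R mat 1 \<and>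
     (\<integral>w. P w ** transpose (P w) ** LL ** P w ** transpose (P w) \<partial>M)
        \<preceq>\<^sub>L (l * opnorm LL) *\<^sub>R mat 1"

text \<open>The Haar probability measure of the orthogonal group, as a Borel measure on the ambient
  matrix space concentrated on the orthogonal matrices. Left invariance determines it uniquely,
  and right invariance follows since the group is compact.\<close>

definition haar_orthogonal :: "(real^'n^'n) measure \<Rightarrow> bool" where
  "haar_orthogonal \<mu> \<longleftrightarrow>
     prob_space \<mu> \<and> sets \<mu> = sets borel \<and>
     (AE Q in \<mu>. orthogonal_matrix Q) \<and>
     (\<forall>U. orthogonal_matrix U \<longrightarrow> distr \<mu> borel (\<lambda>Q. U ** Q) = \<mu>)"

definition haar_distributed :: "'w measure \<Rightarrow> ('w \<Rightarrow> real^'n^'n) \<Rightarrow> bool" where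
  "haar_distributed M Q \<longleftrightarrow> Q \<in> borel_measurable M \<and> haar_orthogonal (distr M borel Q)"

text \<open>\<open>J w j\<close> is the \<open>j\<close>-th sampled column index. The sampled set of indices is uniform among
  all sets of size \<open>CARD('r)\<close>; the joint law of the order in which they are listed is left free,
  so this covers both ordered sampling without replacement and a uniform random subset listed in
  a fixed order.\<close>

definition uniform_distinct_sample :: "'w measure \<Rightarrow> ('w \<Rightarrow> 'r::finite \<Rightarrow> 'd::finite) \<Rightarrow> bool" where
  "uniform_distinct_sample M J \<longleftrightarrow>
     J \<in> measurable M (count_space UNIV) \<and>
     (AE w in M. inj (J w)) \<and>
     distr M (count_space UNIV) (\<lambda>w. range (J w)) =
       measure_pmf (pmf_of_set {A. card A = CARD('r)})"

text \<open>The second parameter of \<^const>\<open>normal_density\<close> is the standard deviation.\<close>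

definition iid_gaussian_entries :: "'w measure \<Rightarrow> ('w \<Rightarrow> real^'r^'d) \<Rightarrow> real \<Rightarrow> bool" where
  "iid_gaussian_entries M P v \<longleftrightarrow>
     prob_space.indep_vars M (\<lambda>_. borel) (\<lambda>(i, j) w. P w $ i $ j) UNIV \<and>
     (\<forall>i j. distributed M lborel (\<lambda>w. P w $ i $ j) (normal_density 0 (sqrt v)))"

end

theory Submission
  imports Defs
begin

text \<open>
  Put \<open>G = P P\<^sup>T\<close>. For Haar and Gaussian sketches the fourth order moments are isotropic:
  \<open>E[G\<^sub>i\<^sub>k G\<^sub>l\<^sub>j] = a \<delta>\<^sub>i\<^sub>k \<delta>\<^sub>l\<^sub>j + b (\<delta>\<^sub>i\<^sub>l \<delta>\<^sub>k\<^sub>j + \<delta>\<^sub>i\<^sub>j \<delta>\<^sub>k\<^sub>l)\<close>, hence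
  \<open>E[G A G] = (a + b) A + b tr(A) I\<close> for symmetric \<open>A\<close>, and both Loewner bounds follow from \<open>A \<preceq> \<parallel>A\<parallel> I\<close>.
  In the Gaussian case this is the fourth order Wick formula. In the Haar case only left invariance
  is needed: sign flips kill the odd moments, permutations leave three constants, a reflection in
  a coordinate plane relates them, and \<open>G\<close> being a multiple of a projection of rank \<open>r\<close> fixes the
  remaining two. For coordinate sampling \<open>G\<close> is diagonal, and \<open>E[G A G]\<close> is a combination
  of \<open>A\<close> and \<open>diag(A)\<close> determined by the inclusion probabilities of one and two indices.
\<close>

subsection \<open>Moments of the Gram matrix\<close>

lemma transpose_eq_selfD: "transpose A = A \<Longrightarrow> A $ j $ i = A $ i $ j"
  by (metis transpose_def vec_lambda_beta)

text \<open>A vector is the finite sum of its coordinates embedded by the bounded linear maps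
  \<open>axis i\<close>, so integrals can be taken coordinatewise. Two applications reduce a matrix
  expectation to its entries.\<close>

lemma has_bochner_integral_vec:
  fixes f :: "'w \<Rightarrow> 'b::euclidean_space^'n"
  assumes "\<And>i. has_bochner_integral M (\<lambda>w. f w $ i) (x $ i)"
  shows "has_bochner_integral M f x"
proof -
  have lin: "bounded_linear (axis i :: 'b \<Rightarrow> 'b^'n)" for i
    by (rule linear_conv_bounded_linear[THEN iffD1], rule linearI)
       (auto simp: axis_def vec_eq_iff)
  have decomp: "(\<Sum>i\<in>UNIV. axis i (y $ i)) = y" for y :: "'b^'n"
    by (simp add: vec_eq_iff axis_def)
  have "has_bochner_integral M (\<lambda>w. \<Sum>i\<in>UNIV. axis i (f w $ i)) (\<Sum>i\<in>UNIV. axis i (x $ i))"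
    by (intro has_bochner_integral_sum has_bochner_integral_bounded_linear[OF lin] assms)
  then show ?thesis
    by (simp add: decomp)
qed

text \<open>Here \<open>T\<close> stands for the map A \<mapsto> E[G A G] on symmetric matrices. The
  last two moment conditions are its values at I and at \<open>LL\<close>, so only the means of the
  entries of G and of their pairwise products have to be computed.\<close>

lemma sketch_moment_conditionsI:
  fixes P :: "'w \<Rightarrow> real^'r^'d" and LL :: "real^'d^'d" and T :: "real^'d^'d \<Rightarrow> real^'d^'d"
  assumes G: "\<And>w. P w ** transpose (P w) = G w"
    and mean: "\<And>i j. has_bochner_integral M (\<lambda>w. G w $ i $ j) (mat 1 $ i $ j)"
    and int: "\<And>i j k l. integrable M (\<lambda>w. G w $ i $ k * G w $ l $ j)"
    and T: "\<And>A i j. transpose A = A \<Longrightarrow>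
      (\<Sum>l\<in>UNIV. \<Sum>k\<in>UNIV. A $ k $ l * (\<integral>w. G w $ i $ k * G w $ l $ j \<partial>M)) = T A $ i $ j"
    and sym: "transpose LL = LL"
    and om: "T (mat 1) \<preceq>\<^sub>L om *\<^sub>R mat 1" and l: "T LL \<preceq>\<^sub>L (l * opnorm LL) *\<^sub>R mat 1"
  shows "sketch_moment_conditions M P LL om l"
proof -
  have 1: "has_bochner_integral M G (mat 1)"
    by (intro has_bochner_integral_vec mean)
  have 2: "has_bochner_integral M (\<lambda>w. G w ** A ** G w) (T A)" if "transpose A = A" for A
  proof (intro has_bochner_integral_vec)
    fix i j
    have "has_bochner_integral M
        (\<lambda>w. \<Sum>l\<in>UNIV. \<Sum>k\<in>UNIV. A $ k $ l * (G w $ i $ k * G w $ l $ j))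
        (\<Sum>l\<in>UNIV. \<Sum>k\<in>UNIV. A $ k $ l * (\<integral>w. G w $ i $ k * G w $ l $ j \<partial>M))"
      by (intro has_bochner_integral_sum has_bochner_integral_mult_right has_bochner_integral_integrable int)
    then show "has_bochner_integral M (\<lambda>w. (G w ** A ** G w) $ i $ j) (T A $ i $ j)"
      unfolding T[OF that]
      by (simp add: matrix_matrix_mult_def sum_distrib_right sum_distrib_left mult_ac)
  qed
  have 3: "P w ** transpose (P w) ** LL ** P w ** transpose (P w) = G w ** LL ** G w" for w
    by (simp add: G[symmetric] matrix_mul_assoc)
  have I: "transpose (mat 1 :: real^'d^'d) = mat 1"
    by (rule transpose_mat)
  show ?thesis
    using 1 2[OF I] 2[OF sym] om l
    unfolding sketch_moment_conditions_def 3 unfolding G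
    by (auto simp: has_bochner_integral_iff)
qed

text \<open>Contracting the three index pairings with A gives a A, b A^T and b tr(A) I; symmetry
  merges the first two.\<close>

lemma isotropic_fourth_moments_sum:
  fixes A :: "real^'d^'d" and E :: "'d \<Rightarrow> 'd \<Rightarrow> 'd \<Rightarrow> 'd \<Rightarrow> real"
  assumes "transpose A = A"
    and E: "\<And>i k l j. E i k l j = a * of_bool (i = k \<and> l = j)
      + b * (of_bool (i = l \<and> k = j) + of_bool (i = j \<and> k = l))"
  shows "(\<Sum>l\<in>UNIV. \<Sum>k\<in>UNIV. A $ k $ l * E i k l j) =
    ((a + b) *\<^sub>R A + (b * trace A) *\<^sub>R mat 1) $ i $ j"
proof -
  have sym: "A $ j $ i = A $ i $ j"
    using assms(1) by (rule transpose_eq_selfD)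
  have "(\<Sum>l\<in>UNIV. \<Sum>k\<in>UNIV. A $ k $ l * E i k l j) =
    (\<Sum>l\<in>UNIV. \<Sum>k\<in>UNIV. (if k = i then (if l = j then a * A $ k $ l else 0) else 0)
       + (if k = j then (if l = i then b * A $ k $ l else 0) else 0)
       + (if k = l then (if i = j then b * A $ k $ l else 0) else 0))"
    by (intro sum.cong refl) (auto simp: E algebra_simps)
  also have "\<dots> = a * A $ i $ j + b * A $ j $ i + (if i = j then b * trace A else 0)"
    by (simp add: sum.distrib trace_def sum_distrib_left)
  finally show ?thesis
    by (simp add: sym mat_def algebra_simps)
qed

section \<open>Loewner bounds by multiples of the identity\<close>

lemma loewner_le_scaleR_mat1:
  "X \<preceq>\<^sub>L c *\<^sub>R mat 1 \<longleftrightarrow> transpose X = X \<and> (\<forall>x. x \<bullet> (X *v x) \<le> c * (x \<bullet> x))"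
proof -
  have "transpose (c *\<^sub>R mat 1 - X) = c *\<^sub>R mat 1 - X \<longleftrightarrow> transpose X = X"
    by (simp add: vec_eq_iff transpose_def mat_def) (metis (no_types))
  moreover have "x \<bullet> ((c *\<^sub>R mat 1 - X) *v x) = c * (x \<bullet> x) - x \<bullet> (X *v x)" for x
    by (simp add: matrix_vector_mult_diff_rdistrib scaleR_matrix_vector_assoc[symmetric] inner_diff_right)
  ultimately show ?thesis
    unfolding loewner_le_def pos_semidef_def by auto
qed

text \<open>Cauchy-Schwarz; for symmetric A this is the Loewner bound of A by its norm times
  I.\<close>

lemma inner_matrix_vector_le_opnorm:
  fixes A :: "real^'n^'n"
  shows "x \<bullet> (A *v x) \<le> opnorm A * (x \<bullet> x)"
proof -
  have "x \<bullet> (A *v x) \<le> norm x * norm (A *v x)"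
    by (rule norm_cauchy_schwarz)
  also have "\<dots> \<le> norm x * (opnorm A * norm x)"
    unfolding opnorm_def by (intro mult_left_mono onorm matrix_vector_mul_bounded_linear) auto
  finally show ?thesis
    by (simp add: dot_square_norm power2_eq_square mult_ac)
qed

lemma scaleR_add_mat_loewner_le:
  fixes A :: "real^'n^'n"
  assumes "transpose A = A" "0 \<le> p"
  shows "p *\<^sub>R A + q *\<^sub>R mat 1 \<preceq>\<^sub>L (p * opnorm A + q) *\<^sub>R mat 1"
proof -
  have "transpose (p *\<^sub>R A + q *\<^sub>R mat 1) = p *\<^sub>R A + q *\<^sub>R mat 1"
    using assms(1) by (auto simp: vec_eq_iff transpose_def mat_def)
  moreover have "p * (x \<bullet> (A *v x)) \<le> p * (opnorm A * (x \<bullet> x))" for x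
    by (intro mult_left_mono inner_matrix_vector_le_opnorm assms)
  ultimately show ?thesis
    unfolding loewner_le_scaleR_mat1
    by (auto simp: matrix_vector_mult_add_rdistrib scaleR_matrix_vector_assoc[symmetric]
        inner_add_right algebra_simps)
qed

lemma opnorm_mat1: "opnorm (mat 1 :: real^'n^'n) = 1"
proof -
  have "onorm (\<lambda>x :: real^'n. x) = 1"
    by (rule onorm_id) 
  then show ?thesis by (simp add: opnorm_def)
qed

lemma trace_mat1: "trace (mat 1 :: real^'n^'n) = real CARD('n)"
  by (simp add: trace_def mat_def)

text \<open>Shared by the Haar and Gaussian sketches, which differ only in a and b. Since tr(I) = d,
  the value at I is (a + b + b d) I. The equation for \<open>l\<close> is multiplied by the norm, so
  the division is left to the two instances.\<close>

lemma isotropic_sketch_moment_conditions: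
  fixes P :: "'w \<Rightarrow> real^'r^'d" and LL :: "real^'d^'d"
  assumes G: "\<And>w. P w ** transpose (P w) = G w"
    and mean: "\<And>i j. has_bochner_integral M (\<lambda>w. G w $ i $ j) (mat 1 $ i $ j)"
    and int: "\<And>i j k l. has_bochner_integral M (\<lambda>w. G w $ i $ k * G w $ l $ j)
       (a * of_bool (i = k \<and> l = j)
      + b * (of_bool (i = l \<and> k = j) + of_bool (i = j \<and> k = l)))"
    and sym: "transpose LL = LL" and ab: "0 \<le> a + b"
    and om: "om = a + b + b * CARD('d)" and l: "l * opnorm LL = (a + b) * opnorm LL + b * trace LL"
  shows "sketch_moment_conditions M P LL om l"
proof (rule sketch_moment_conditionsI[OF G mean])
  show "integrable M (\<lambda>w. G w $ i $ k * G w $ l $ j)" for i j k l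
    using int by (rule integrable.intros)
  show "(\<Sum>l\<in>UNIV. \<Sum>k\<in>UNIV. A $ k $ l * (\<integral>w. G w $ i $ k * G w $ l $ j \<partial>M)) =
    ((a + b) *\<^sub>R A + (b * trace A) *\<^sub>R mat 1) $ i $ j" if "transpose A = A" for A :: "real^'d^'d" and i j
    using that has_bochner_integral_integral_eq[OF int] by (rule isotropic_fourth_moments_sum)
  show "(a + b) *\<^sub>R mat 1 + (b * trace (mat 1 :: real^'d^'d)) *\<^sub>R mat 1 \<preceq>\<^sub>L om *\<^sub>R (mat 1 :: real^'d^'d)"
    using scaleR_add_mat_loewner_le[OF transpose_mat[of 1] ab, of "b * trace (mat 1 :: real^'d^'d)"]
    by (simp add: om trace_mat1 opnorm_mat1)
  show "(a + b) *\<^sub>R LL + (b * trace LL) *\<^sub>R mat 1 \<preceq>\<^sub>L (l * opnorm LL) *\<^sub>R mat 1"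
    unfolding l by (rule scaleR_add_mat_loewner_le[OF sym ab])
qed (rule sym)

subsection \<open>Norm and trace of positive semidefinite matrices\<close>

lemma pos_semidef_diag_nonneg:
  assumes "pos_semidef A"
  shows "0 \<le> A $ i $ i"
proof -
  have "0 \<le> axis i 1 \<bullet> (A *v axis i 1)"
    using assms unfolding pos_semidef_def by blast
  then show ?thesis
    by (simp add: inner_axis' matrix_vector_mult_basis column_def)
qed

text \<open>The 2 x 2 principal minors are nonnegative: the quadratic form is restricted to t e_i +
  s e_j and suitable s, t are inserted.\<close>

lemma pos_semidef_entry_sq_le:
  fixes A :: "real^'n^'n"
  assumes "pos_semidef A"
  shows "(A $ i $ j)\<^sup>2 \<le> A $ i $ i * A $ j $ j"
proof -
  have sym: "A $ j $ i = A $ i $ j"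
    using assms transpose_eq_selfD unfolding pos_semidef_def by blast
  have col: "(A *v axis j 1) $ i = A $ i $ j" for i j
    by (simp add: matrix_vector_mult_basis column_def)
  have "0 \<le> t\<^sup>2 * A $ i $ i + 2 * t * s * A $ i $ j + s\<^sup>2 * A $ j $ j" for s t
  proof -
    have "0 \<le> (t *\<^sub>R axis i 1 + s *\<^sub>R axis j 1) \<bullet> (A *v (t *\<^sub>R axis i 1 + s *\<^sub>R axis j 1))"
      using assms unfolding pos_semidef_def by blast
    also have "\<dots> = t\<^sup>2 * A $ i $ i + 2 * t * s * A $ i $ j + s\<^sup>2 * A $ j $ j"
      by (simp add: matrix_vector_right_distrib matrix_vector_mult_scaleR inner_add_left inner_add_right
          inner_axis' col sym power2_eq_square algebra_simps)
    finally show ?thesis .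
  qed
  note q = this
  have ii: "0 \<le> A $ i $ i" and jj: "0 \<le> A $ j $ j"
    using assms by (rule pos_semidef_diag_nonneg)+
  show ?thesis
  proof (cases "A $ i $ i = 0")
    case True
    \<comment> \<open>With A_ii = 0 the form is affine in t, and the chosen t makes it the negative
      of the left-hand side; this forces A_ij = 0.\<close>
    have "(A $ i $ j)\<^sup>2 * (A $ j $ j + 2) \<le> 0"
      using q[of "- (A $ j $ j + 1)" "A $ i $ j"] True jj
      by (simp add: power2_eq_square algebra_simps)
    then show ?thesis using True jj by (simp add: mult_le_0_iff)
  next
    case False
    \<comment> \<open>For s = A_ii the form is minimal at t = -A_ij, with value A_ii times the
      minor.\<close>
    have "0 \<le> A $ i $ i * (A $ i $ i * A $ j $ j - (A $ i $ j)\<^sup>2)"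
      using q[of "- A $ i $ j" "A $ i $ i"] by (simp add: power2_eq_square algebra_simps)
    then show ?thesis using False ii by (simp add: zero_le_mult_iff)
  qed
qed

text \<open>The operator norm is at most the Frobenius norm, by Cauchy-Schwarz on each row, and the
  minor inequality bounds the squared Frobenius norm by the sum of all A_ii A_jj, which is
  tr(A)^2.\<close>

lemma opnorm_le_trace:
  fixes A :: "real^'n^'n"
  assumes "pos_semidef A"
  shows "opnorm A \<le> trace A"
  unfolding opnorm_def
proof (rule onorm_le)
  fix x :: "real^'n"
  have tr: "0 \<le> trace A"
    unfolding trace_def by (intro sum_nonneg pos_semidef_diag_nonneg assms)
  have "(norm (A *v x))\<^sup>2 = (\<Sum>i\<in>UNIV. (A $ i \<bullet> x)\<^sup>2)"
    unfolding power2_norm_eq_inner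
    by (simp add: inner_vec_def matrix_vector_mult_def power2_eq_square)
  also have "\<dots> \<le> (\<Sum>i\<in>UNIV. (A $ i \<bullet> A $ i) * (x \<bullet> x))"
    by (intro sum_mono Cauchy_Schwarz_ineq)
  also have "\<dots> = (\<Sum>i\<in>UNIV. \<Sum>j\<in>UNIV. (A $ i $ j)\<^sup>2) * (x \<bullet> x)"
    by (simp add: sum_distrib_right inner_vec_def[of "A $ _"] power2_eq_square)
  also have "\<dots> \<le> (\<Sum>i\<in>UNIV. \<Sum>j\<in>UNIV. A $ i $ i * A $ j $ j) * (x \<bullet> x)"
    by (intro mult_right_mono sum_mono pos_semidef_entry_sq_le assms) auto
  also have "\<dots> = (trace A * norm x)\<^sup>2"
    by (simp add: trace_def sum_product power_mult_distrib power2_norm_eq_inner power2_eq_square[of "sum _ _"])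
  finally show "norm (A *v x) \<le> trace A * norm x"
    by (rule power2_le_imp_le) (use tr in simp)
qed

lemma opnorm_nonneg: "0 \<le> opnorm A"
  unfolding opnorm_def by (intro onorm_pos_le matrix_vector_mul_bounded_linear)

lemma abs_entry_le_opnorm: "\<bar>A $ i $ j\<bar> \<le> opnorm A"
  unfolding opnorm_def by (rule matrix_component_le_onorm)

text \<open>The diagonal part rescales each coordinate by an entry of A, and every entry is bounded
  by the operator norm.\<close>

lemma opnorm_diag_part_le:
  fixes A :: "real^'n^'n"
  shows "opnorm (diag_part A) \<le> opnorm A"
  unfolding opnorm_def[of "diag_part A"]
proof (rule onorm_le)
  fix x :: "real^'n"
  have "(norm (diag_part A *v x))\<^sup>2 = (\<Sum>i\<in>UNIV. (A $ i $ i)\<^sup>2 * (x $ i)\<^sup>2)"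
    unfolding power2_norm_eq_inner
    by (simp add: inner_vec_def matrix_vector_mult_def diag_part_def
        if_distrib[of "\<lambda>y. y * _"] power2_eq_square cong: if_cong)
      (simp add: mult_ac)
  also have "\<dots> \<le> (\<Sum>i\<in>UNIV. (opnorm A)\<^sup>2 * (x $ i)\<^sup>2)"
    by (intro sum_mono mult_right_mono) (simp_all add: power2_le_iff_abs_le opnorm_nonneg abs_entry_le_opnorm)
  also have "\<dots> = (opnorm A * norm x)\<^sup>2"
    unfolding power_mult_distrib power2_norm_eq_inner
    by (simp add: inner_vec_def sum_distrib_left power2_eq_square)
  finally show "norm (diag_part A *v x) \<le> opnorm A * norm x"
    by (rule power2_le_imp_le) (intro mult_nonneg_nonneg opnorm_nonneg norm_ge_zero)
qed

lemma trace_le_opnorm_diag_part: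
  fixes A :: "real^'n^'n"
  shows "trace A \<le> CARD('n) * opnorm (diag_part A)"
proof -
  have "trace A \<le> (\<Sum>i\<in>(UNIV :: 'n set). opnorm (diag_part A))"
    unfolding trace_def
  proof (rule sum_mono)
    fix i
    show "A $ i $ i \<le> opnorm (diag_part A)"
      using abs_entry_le_opnorm[of "diag_part A" i i] by (simp add: diag_part_def)
  qed
  then show ?thesis by simp
qed

subsection \<open>Haar measure on the orthogonal group\<close>

lemma matrix_mult_nth_inner: "(U ** Q) $ i $ j = U $ i \<bullet> column j Q" for Q :: "real^'n^'m"
  by (simp add: matrix_matrix_mult_def inner_vec_def column_def)

text \<open>Stated for rows because the matrices acting from the left below are written row by row
  with \<open>axis\<close>.\<close>

lemma orthogonal_matrixI_rows:
  fixes U :: "real^'n^'n"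
  assumes "\<And>k l. U $ k \<bullet> U $ l = of_bool (k = l)"
  shows "orthogonal_matrix U"
proof -
  have "U ** transpose U = mat 1"
    using assms by (simp add: vec_eq_iff matrix_mult_nth_inner column_transpose row_def mat_def)
  then have "orthogonal_matrix (transpose U)"
    by (simp add: orthogonal_matrix)
  then show ?thesis by simp
qed

text \<open>Double transitivity of the permutations. The first transposition moves i to k; the
  second moves the image of j to l and fixes k, because neither that image nor l equals k.\<close>

lemma obtain_permutation_pair:
  fixes i j k l :: 'a
  assumes "i \<noteq> j" "k \<noteq> l"
  obtains p where "bij p" "p i = k" "p j = l"
proof
  let ?t = "Transposition.transpose i k"
  show "bij (Transposition.transpose (?t j) l \<circ> ?t)"
    by (intro bij_comp bij_swap_iff[THEN iffD2] bij_transpose) 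
  show "(Transposition.transpose (?t j) l \<circ> ?t) i = k" "(Transposition.transpose (?t j) l \<circ> ?t) j = l"
    using assms by (auto simp: Transposition.transpose_def)
qed

text \<open>The entries of S S^T, where S consists of the columns of Q listed by c. For orthogonal Q
  and injective c this is the orthogonal projection onto the span of these columns.\<close>

definition col_gram :: "('r::finite \<Rightarrow> 'n::finite) \<Rightarrow> real^'n^'n \<Rightarrow> 'n \<Rightarrow> 'n \<Rightarrow> real" where
  "col_gram c Q i k = (\<Sum>a\<in>UNIV. Q $ i $ c a * Q $ k $ c a)"

lemma col_gram_sym: "col_gram c Q i k = col_gram c Q k i"
  by (simp add: col_gram_def mult.commute)

lemma col_gram_borel [measurable]: "(\<lambda>Q. col_gram c Q i k) \<in> borel_measurable borel"
  unfolding col_gram_def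
  by (intro borel_measurable_continuous_onI continuous_intros)

context
  fixes c :: "'r::finite \<Rightarrow> 'n::finite" and Q :: "real^'n^'n"
  assumes orth: "orthogonal_matrix Q"
begin

lemma orthogonal_matrix_columns: "(\<Sum>i\<in>UNIV. Q $ i $ j * Q $ i $ k) = of_bool (j = k)"
proof -
  have "(transpose Q ** Q) $ j $ k = of_bool (j = k)"
    using orth by (simp add: orthogonal_matrix mat_def)
  then show ?thesis
    by (simp add: matrix_matrix_mult_def transpose_def)
qed

text \<open>A crude bound whose purpose is integrability: bounded measurable functions are
  integrable under a probability measure.\<close>

lemma abs_col_gram_le: "\<bar>col_gram c Q i k\<bar> \<le> CARD('r)"
proof -
  have Q1: "\<bar>Q $ i $ j\<bar> \<le> 1" for i j
  proof -
    have "(Q $ i $ j)\<^sup>2 \<le> (\<Sum>i\<in>UNIV. (Q $ i $ j)\<^sup>2)"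
      by (rule member_le_sum) auto
    then show ?thesis
      using orthogonal_matrix_columns[of j j]
      by (simp add: power2_eq_square[symmetric] abs_square_le_1)
  qed
  have "\<bar>Q $ i $ j * Q $ k $ l\<bar> \<le> 1" for i j k l
    unfolding abs_mult by (intro mult_le_one Q1 abs_ge_zero)
  then have "\<bar>col_gram c Q i k\<bar> \<le> (\<Sum>a\<in>(UNIV::'r set). 1)"
    unfolding col_gram_def by (intro order_trans[OF sum_abs] sum_mono) auto
  then show ?thesis by simp
qed

lemma sum_col_gram_diag: "(\<Sum>i\<in>UNIV. col_gram c Q i i) = CARD('r)"
  unfolding col_gram_def by (subst sum.swap) (simp add: orthogonal_matrix_columns)

text \<open>S S^T S S^T = S S^T, because the selected columns are distinct and orthonormal, so that
  S^T S = I.\<close>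

lemma col_gram_idem:
  assumes "inj c"
  shows "(\<Sum>l\<in>UNIV. col_gram c Q i l * col_gram c Q l k) = col_gram c Q i k"
proof -
  have "(\<Sum>l\<in>UNIV. col_gram c Q i l * col_gram c Q l k) =
    (\<Sum>l\<in>UNIV. \<Sum>a\<in>UNIV. \<Sum>b\<in>UNIV. Q $ i $ c a * Q $ k $ c b * (Q $ l $ c a * Q $ l $ c b))"
    by (simp add: col_gram_def sum_product mult_ac)
  also have "\<dots> = (\<Sum>a\<in>UNIV. \<Sum>b\<in>UNIV. Q $ i $ c a * Q $ k $ c b * (\<Sum>l\<in>UNIV. Q $ l $ c a * Q $ l $ c b))"
    unfolding sum_distrib_left by (subst sum.swap, intro sum.cong refl, subst sum.swap) simp
  also have "\<dots> = col_gram c Q i k"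
    by (simp add: orthogonal_matrix_columns inj_eq[OF assms] col_gram_def)
  finally show ?thesis .
qed

end

section \<open>Moments of the projection entries under Haar measure\<close>

locale haar_columns =
  fixes \<mu> :: "(real^'n^'n) measure" and c :: "'r::finite \<Rightarrow> 'n::finite"
  assumes haar: "haar_orthogonal \<mu>" and inj_c: "inj c"
begin

sublocale prob_space \<mu>
  using haar by (simp add: haar_orthogonal_def)

lemma sets_haar [measurable_cong]: "sets \<mu> = sets borel"
  and AE_orthogonal: "AE Q in \<mu>. orthogonal_matrix Q"
  using haar by (simp_all add: haar_orthogonal_def)

text \<open>Each orthogonal U inserted here yields a relation among the moments; permutation, sign
  and reflection matrices are used.\<close>

lemma integral_left_invariant:
  fixes f :: "real^'n^'n \<Rightarrow> real"
  assumes "orthogonal_matrix U" and [measurable]: "f \<in> borel_measurable borel"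
  shows "(\<integral>Q. f (U ** Q) \<partial>\<mu>) = (\<integral>Q. f Q \<partial>\<mu>)"
proof -
  have [measurable]: "(\<lambda>Q. U ** Q) \<in> borel_measurable borel"
    unfolding matrix_matrix_mult_def
    by (intro borel_measurable_continuous_onI continuous_intros)
  have "(\<integral>Q. f Q \<partial>\<mu>) = (\<integral>Q. f Q \<partial>distr \<mu> borel (\<lambda>Q. U ** Q))"
    using haar assms(1) by (simp add: haar_orthogonal_def)
  also have "\<dots> = (\<integral>Q. f (U ** Q) \<partial>\<mu>)"
    by (rule integral_distr) measurable
  finally show ?thesis by simp
qed

abbreviation "G \<equiv> col_gram c"

definition "gram_moment2 i k = (\<integral>Q. G Q i k \<partial>\<mu>)"
definition "gram_moment4 i k l j = (\<integral>Q. G Q i k * G Q l j \<partial>\<mu>)"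

lemma integrable_gram [simp]: "integrable \<mu> (\<lambda>Q. G Q i k)"
  by (rule integrable_const_bound[where B="CARD('r)"])
     (use AE_orthogonal in \<open>auto elim!: eventually_mono simp: abs_col_gram_le\<close>)

lemma integrable_gram_mult [simp]: "integrable \<mu> (\<lambda>Q. G Q i k * G Q l j)"
  by (rule integrable_const_bound[where B="real CARD('r) * CARD('r)"])
     (use AE_orthogonal in \<open>auto elim!: eventually_mono simp: abs_mult intro!: mult_mono abs_col_gram_le\<close>)

text \<open>Left multiplication by the permutation matrix with rows \<open>axis (p i) 1\<close>
  relabels the rows of Q, and hence both indices of G.\<close>

lemma gram_moment4_permute:
  assumes "bij p"
  shows "gram_moment4 (p i) (p k) (p l) (p j) = gram_moment4 i k l j"
proof -
  let ?U = "(\<chi> i. axis (p i) 1) :: real^'n^'n"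
  have "orthogonal_matrix ?U"
    using assms by (intro orthogonal_matrixI_rows) (simp add: inner_axis_axis bij_is_inj inj_eq)
  moreover have "G (?U ** Q) i k = G Q (p i) (p k)" for Q i k
    by (simp add: col_gram_def matrix_mult_nth_inner inner_axis' column_def)
  ultimately show ?thesis
    using integral_left_invariant[of ?U "\<lambda>Q. G Q i k * G Q l j"]
    by (simp add: gram_moment4_def)
qed

text \<open>A diagonal sign matrix multiplies the moment by the product of its four signs; if this
  is -1, the moment equals its own negative.\<close>

lemma gram_moment4_flip:
  assumes s: "\<And>i. s i = 1 \<or> s i = -1" and "s i * s k * s l * s j = (-1::real)"
  shows "gram_moment4 i k l j = 0"
proof -
  let ?U = "(\<chi> i. axis i (s i)) :: real^'n^'n"
  have "s i * s i = 1" for i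
    using s[of i] by auto
  then have "orthogonal_matrix ?U"
    by (intro orthogonal_matrixI_rows) (simp add: inner_axis_axis)
  moreover have "G (?U ** Q) i k = s i * s k * G Q i k" for Q i k
    by (simp add: col_gram_def matrix_mult_nth_inner inner_axis' column_def sum_distrib_left mult_ac)
  ultimately have "gram_moment4 i k l j = (\<integral>Q. (s i * s k * s l * s j) * (G Q i k * G Q l j) \<partial>\<mu>)"
    using integral_left_invariant[of ?U "\<lambda>Q. G Q i k * G Q l j"]
    by (simp add: gram_moment4_def mult_ac)
  also have "\<dots> = - gram_moment4 i k l j"
    unfolding assms by (simp add: gram_moment4_def)
  finally show ?thesis by simp
qed

lemma gram_moment4_odd:
  assumes "\<not> (i = k \<and> l = j)" "\<not> (i = l \<and> k = j)" "\<not> (i = j \<and> k = l)"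
  shows "gram_moment4 i k l j = 0"
proof -
  \<comment> \<open>An index value that occurs once or three times among i, k, l, j; flipping only
    this coordinate gives total sign -1.\<close>
  define m where "m = (if i = k then l else if i = l then k else if i = j then k else i)"
  show ?thesis
    by (rule gram_moment4_flip[of "\<lambda>x. if x = m then -1 else 1"])
       (use assms in \<open>auto simp: m_def split: if_splits\<close>)
qed

text \<open>The reflection replacing rows i and j by their normalised sum and difference turns G_ij
  into (G_ii - G_jj) / 2; invariance is then applied to the square.\<close>

lemma gram_moment4_reflect:
  assumes "i \<noteq> j"
  shows "4 * gram_moment4 i j i j = gram_moment4 i i i i + gram_moment4 j j j j - 2 * gram_moment4 i i j j"
proof -
  define s :: real where "s = sqrt (1 / 2)"
  have s: "s * s = 1 / 2" by (simp add: s_def)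
  let ?U = "(\<chi> k. if k = i then axis i s + axis j s else if k = j then axis i s + axis j (- s)
    else axis k 1) :: real^'n^'n"
  have "orthogonal_matrix ?U"
    using assms by (intro orthogonal_matrixI_rows) (auto simp: inner_axis_axis inner_add_left inner_add_right s)
  have "G (?U ** Q) i j = (G Q i i - G Q j j) / 2" for Q
  proof -
    have "G (?U ** Q) i j = (\<Sum>a\<in>UNIV. (s * s) * ((Q $ i $ c a + Q $ j $ c a) * (Q $ i $ c a - Q $ j $ c a)))"
      using assms by (auto simp: col_gram_def matrix_mult_nth_inner inner_add_left inner_axis' column_def
          algebra_simps intro!: sum.cong)
    also have "\<dots> = (\<Sum>a\<in>UNIV. (Q $ i $ c a * Q $ i $ c a - Q $ j $ c a * Q $ j $ c a) / 2)"
      unfolding s by (intro sum.cong refl) (simp add: algebra_simps)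
    finally show ?thesis
      by (simp add: col_gram_def sum_subtractf[symmetric] sum_divide_distrib)
  qed
  note gram_U = this
  have "gram_moment4 i j i j = (\<integral>Q. G (?U ** Q) i j * G (?U ** Q) i j \<partial>\<mu>)"
    using integral_left_invariant[OF \<open>orthogonal_matrix ?U\<close>, of "\<lambda>Q. G Q i j * G Q i j"]
    by (simp add: gram_moment4_def)
  also have "\<dots> = (\<integral>Q. ((G Q i i - G Q j j) / 2) * ((G Q i i - G Q j j) / 2) \<partial>\<mu>)"
    by (simp only: gram_U)
  also have "\<dots> = (\<integral>Q. (G Q i i * G Q i i + G Q j j * G Q j j - 2 * (G Q i i * G Q j j)) / 4 \<partial>\<mu>)"
    by (intro Bochner_Integration.integral_cong refl) (simp add: field_simps)
  also have "\<dots> = (gram_moment4 i i i i + gram_moment4 j j j j - 2 * gram_moment4 i i j j) / 4"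
    by (simp add: gram_moment4_def)
  finally show ?thesis by simp
qed

text \<open>Up to permutation the surviving moments are E[G_ii^2], v = E[G_ii G_jj] and w =
  E[G_ij^2] with i \<noteq> j. The reflection gives E[G_ii^2] = v + 2 w, which is what the isotropic
  form prescribes when all indices agree.\<close>

lemma gram_moment4_isotropic:
  assumes "2 \<le> CARD('n)"
  obtains v w where "\<And>i k l j. gram_moment4 i k l j =
    v * of_bool (i = k \<and> l = j) + w * (of_bool (i = l \<and> k = j) + of_bool (i = j \<and> k = l))"
proof -
  obtain x y :: 'n where xy: "x \<noteq> y"
    using assms by (metis card_2_iff' card_le_Suc0_iff_eq finite not_less_eq_eq numeral_2_eq_2 UNIV_I)
  define v w where "v = gram_moment4 x x y y" and "w = gram_moment4 x y x y"
  have v: "gram_moment4 i i j j = v" and w: "gram_moment4 i j i j = w" and diag: "gram_moment4 i i i i = gram_moment4 x x x x"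
    if ij: "i \<noteq> j" for i j
  proof -
    obtain p where "bij p" "p x = i" "p y = j"
      by (rule obtain_permutation_pair[OF xy ij])
    then show "gram_moment4 i i j j = v" "gram_moment4 i j i j = w" "gram_moment4 i i i i = gram_moment4 x x x x"
      using gram_moment4_permute[of p x x y y] gram_moment4_permute[of p x y x y] gram_moment4_permute[of p x x x x]
      by (simp_all add: v_def w_def)
  qed
  have u: "gram_moment4 i i i i = v + 2 * w" for i
  proof -
    obtain j where "i \<noteq> j" using xy by metis
    then show ?thesis
      using gram_moment4_reflect[of i j] v[of i j] w[of i j] diag[of i j] diag[of j i] by simp
  qed
  have w': "gram_moment4 i j j i = w" if "i \<noteq> j" for i j
    using w[OF that] by (simp add: gram_moment4_def col_gram_sym[of c _ j i])
  show ?thesis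
  proof (rule that[of v w])
    show "gram_moment4 i k l j = v * of_bool (i = k \<and> l = j)
      + w * (of_bool (i = l \<and> k = j) + of_bool (i = j \<and> k = l))" for i k l j
      using gram_moment4_odd[of i k l j] u[of i] v[of i j] w[of i k] w'[of i k]
      by (cases "i = k"; cases "l = j"; cases "i = l"; cases "i = j") auto
  qed
qed

end

context haar_columns
begin

text \<open>Isotropy leaves the unknowns v and w. Idempotence expresses the mean through them, and
  tr G = r supplies two equations: its expectation and that of its square. The factor d / r is the
  square of the scaling of the sketch.\<close>

lemma gram_moments:
  fixes d r :: real
  assumes d2: "2 \<le> CARD('n)"
  defines "d \<equiv> CARD('n)" and "r \<equiv> CARD('r)"
  defines "\<beta> \<equiv> d * (d - r) / ((d + 2) * (d - 1))"
  shows "has_bochner_integral \<mu> (\<lambda>Q. d / r * G Q i k) (mat 1 $ i $ k)"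
    and "has_bochner_integral \<mu> (\<lambda>Q. d / r * G Q i k * (d / r * G Q l j))
      ((d / r * (1 - \<beta>) - \<beta> / r) * of_bool (i = k \<and> l = j)
        + \<beta> / r * (of_bool (i = l \<and> k = j) + of_bool (i = j \<and> k = l)))"
proof -
  have pos: "0 < r" "2 \<le> d" using d2 by (simp_all add: r_def d_def)
  obtain v w where gram_moment4: "\<And>i k l j. gram_moment4 i k l j =
    v * of_bool (i = k \<and> l = j) + w * (of_bool (i = l \<and> k = j) + of_bool (i = j \<and> k = l))"
    using gram_moment4_isotropic[OF d2] by blast
  \<comment> \<open>Since G = G^2 almost everywhere, the mean is a sum of fourth moments.\<close>
  have gram_moment2: "gram_moment2 i k = (v + (d + 1) * w) * of_bool (i = k)" for i k
  proof -
    have "gram_moment2 i k = (\<integral>Q. (\<Sum>l\<in>UNIV. G Q i l * G Q l k) \<partial>\<mu>)"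
      unfolding gram_moment2_def
      by (intro integral_cong_AE) (use AE_orthogonal in \<open>auto elim!: eventually_mono simp: col_gram_idem inj_c\<close>)
    also have "\<dots> = (\<Sum>l\<in>UNIV. gram_moment4 i l l k)"
      by (simp add: gram_moment4_def)
    also have "\<dots> = (\<Sum>l\<in>UNIV. (if l = i then (v + w) * of_bool (i = k) else 0) + w * of_bool (i = k))"
      by (intro sum.cong) (auto simp: gram_moment4)
    also have "\<dots> = (v + (d + 1) * w) * of_bool (i = k)"
      by (simp add: sum.distrib d_def algebra_simps)
    finally show ?thesis .
  qed
  have sum_G: "AE Q in \<mu>. (\<Sum>i\<in>UNIV. G Q i i) = r"
    using AE_orthogonal by eventually_elim (simp add: sum_col_gram_diag r_def)
  have "(\<integral>Q. (\<Sum>i\<in>UNIV. G Q i i) \<partial>\<mu>) = (\<integral>Q. r \<partial>\<mu>)"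
    by (intro integral_cong_AE) (use sum_G in auto)
  then have eq1: "d * (v + (d + 1) * w) = r"
    by (simp add: gram_moment2_def[symmetric] gram_moment2 prob_space d_def[symmetric])
  have "(\<integral>Q. (\<Sum>i\<in>UNIV. \<Sum>j\<in>UNIV. G Q i i * G Q j j) \<partial>\<mu>) = (\<integral>Q. r * r \<partial>\<mu>)"
    by (intro integral_cong_AE) (use sum_G in \<open>auto elim!: eventually_mono simp: sum_product[symmetric]\<close>)
  then have "(\<Sum>i\<in>UNIV. \<Sum>j\<in>UNIV. gram_moment4 i i j j) = r * r"
    by (simp add: gram_moment4_def prob_space)
  moreover have "(\<Sum>i\<in>UNIV. \<Sum>j\<in>UNIV. gram_moment4 i i j j) = (\<Sum>i\<in>(UNIV :: 'n set). \<Sum>j\<in>(UNIV :: 'n set). v + (if i = j then 2 * w else 0))"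
    by (intro sum.cong refl) (auto simp: gram_moment4)
  ultimately have eq2: "d * (d * v + 2 * w) = r * r"
    by (simp add: sum.distrib d_def algebra_simps)
  \<comment> \<open>Subtracting \<open>eq2\<close> from d times \<open>eq1\<close> eliminates v; the
    coefficient d^2 + d - 2 factors as (d + 2)(d - 1), the denominator of
    \<open>\<beta>\<close>.\<close>
  have "d * (d * (v + (d + 1) * w)) - d * (d * v + 2 * w) = d * r - r * r"
    unfolding eq1 eq2 ..
  then have Dw: "d * ((d + 2) * (d - 1)) * w = r * (d - r)"
    by (simp add: algebra_simps)
  define D where "D = (d + 2) * (d - 1)"
  have D: "D \<noteq> 0" using pos by (simp add: D_def)
  have w: "w = r * (d - r) / (d * D)"
    unfolding Dw[folded D_def, symmetric] using pos D by simp
  have b: "(d / r)\<^sup>2 * w = \<beta> / r"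
    unfolding w \<beta>_def D_def[symmetric] using pos D by (simp add: power2_eq_square)
  have vw: "v + (d + 1) * w = r / d"
    using eq1 pos by (simp add: field_simps)
  \<comment> \<open>The mean condition v + (d + 1) w = r / d converts the scaled w into the scaled
    v.\<close>
  have "(d / r)\<^sup>2 * v = (d / r)\<^sup>2 * (v + (d + 1) * w) - (d + 1) * ((d / r)\<^sup>2 * w)"
    by (simp add: algebra_simps)
  also have "\<dots> = d / r * (1 - \<beta>) - \<beta> / r"
    unfolding b vw using pos by (simp add: power2_eq_square field_simps)
  finally have a: "(d / r)\<^sup>2 * v = d / r * (1 - \<beta>) - \<beta> / r" .
  have "(\<integral>Q. d / r * G Q i k \<partial>\<mu>) = mat 1 $ i $ k"
    using pos by (simp add: gram_moment2_def[symmetric] gram_moment2 vw mat_def)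
  then show "has_bochner_integral \<mu> (\<lambda>Q. d / r * G Q i k) (mat 1 $ i $ k)"
    by (simp add: has_bochner_integral_iff)
  have scale: "d / r * G Q i k * (d / r * G Q l j) = (d / r)\<^sup>2 * (G Q i k * G Q l j)" for Q
    by (simp add: power2_eq_square mult_ac)
  have "(\<integral>Q. d / r * G Q i k * (d / r * G Q l j) \<partial>\<mu>) = (d / r)\<^sup>2 * gram_moment4 i k l j"
    unfolding scale by (simp add: gram_moment4_def)
  also have "\<dots> = (d / r)\<^sup>2 * v * of_bool (i = k \<and> l = j)
      + (d / r)\<^sup>2 * w * (of_bool (i = l \<and> k = j) + of_bool (i = j \<and> k = l))"
    by (simp only: gram_moment4 distrib_left mult.assoc)
  finally show "has_bochner_integral \<mu> (\<lambda>Q. d / r * G Q i k * (d / r * G Q l j))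
      ((d / r * (1 - \<beta>) - \<beta> / r) * of_bool (i = k \<and> l = j)
        + \<beta> / r * (of_bool (i = l \<and> k = j) + of_bool (i = j \<and> k = l)))"
    unfolding a b scale by (simp add: has_bochner_integral_iff)
qed

end

section \<open>From Haar moments to the scaled Haar sketch\<close>

lemma has_bochner_integral_distr:
  assumes "X \<in> measurable M N" "has_bochner_integral (distr M N X) f x" "f \<in> borel_measurable N"
  shows "has_bochner_integral M (\<lambda>w. f (X w)) (x :: real)"
  using assms by (auto simp: has_bochner_integral_iff integrable_distr_eq integral_distr)

lemma gram_scaleR_select_columns:
  "(s *\<^sub>R select_columns c Q ** transpose (s *\<^sub>R select_columns c Q)) $ i $ k = s\<^sup>2 * col_gram c Q i k"
  by (simp add: matrix_matrix_mult_def transpose_def select_columns_def col_gram_def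
      sum_distrib_left power2_eq_square mult_ac)

text \<open>With b = \<open>\<beta> / r\<close> one has a + b = (d / r)(1 - \<open>\<beta>\<close>)
  and b d = \<open>\<beta>\<close> d / r; these add up to \<open>om\<close> = d / r, and dividing b
  tr(\<open>LL\<close>) by the norm gives the second summand of \<open>l\<close>.\<close>

lemma haar_sketch_moment_conditions:
  fixes Q :: "'w \<Rightarrow> real^'d^'d" and c :: "'r::finite \<Rightarrow> 'd" and LL :: "real^'d^'d" and d r :: real
  assumes Q: "haar_distributed M Q" and c: "inj c" and d2: "2 \<le> CARD('d)"
    and LL: "transpose LL = LL" and L: "0 < opnorm LL"
  defines "d \<equiv> CARD('d)" and "r \<equiv> CARD('r)"
  defines "\<beta> \<equiv> d * (d - r) / ((d + 2) * (d - 1))"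
  shows "sketch_moment_conditions M (\<lambda>w. sqrt (d / r) *\<^sub>R select_columns c (Q w)) LL (d / r)
    (d / r * (1 - \<beta> + \<beta> * (trace LL / opnorm LL / d)))"
proof -
  have Qm [measurable]: "Q \<in> borel_measurable M"
    using Q by (simp add: haar_distributed_def)
  interpret haar_columns "distr M borel Q" c
    using Q c by (simp add: haar_columns_def haar_distributed_def)
  have pos: "1 \<le> r" "2 \<le> d" using d2 by (simp_all add: r_def d_def Suc_le_eq)
  define P where "P = (\<lambda>w. sqrt (d / r) *\<^sub>R select_columns c (Q w))"
  have G: "(P w ** transpose (P w)) $ i $ k = d / r * col_gram c (Q w) i k" for w i k
    unfolding P_def gram_scaleR_select_columns using pos by simp
  show ?thesis
    unfolding P_def[symmetric]
  proof (rule isotropic_sketch_moment_conditions[OF refl _ _ LL])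
    show "has_bochner_integral M (\<lambda>w. (P w ** transpose (P w)) $ i $ k) (mat 1 $ i $ k)" for i k
      unfolding G by (rule has_bochner_integral_distr[OF Qm])
        (use gram_moments(1)[OF d2] in \<open>auto simp: d_def r_def\<close>)
    show "has_bochner_integral M (\<lambda>w. (P w ** transpose (P w)) $ i $ k * (P w ** transpose (P w)) $ l $ j)
      ((d / r * (1 - \<beta>) - \<beta> / r) * of_bool (i = k \<and> l = j)
        + \<beta> / r * (of_bool (i = l \<and> k = j) + of_bool (i = j \<and> k = l)))" for i j k l
      unfolding G by (rule has_bochner_integral_distr[OF Qm, where f="\<lambda>Q. d / r * col_gram c Q i k * (d / r * col_gram c Q l j)"])
        (use gram_moments(2)[OF d2] in \<open>auto simp: d_def r_def \<beta>_def\<close>)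
    \<comment> \<open>This gap is nonnegative as d \<ge> 2, so \<open>\<beta>\<close> \<le> 1, which
      amounts to a + b \<ge> 0.\<close>
    have "(d + 2) * (d - 1) - d * (d - r) = d * r + d - 2"
      by (simp add: algebra_simps)
    moreover have "0 \<le> d * r"
      using pos by simp
    ultimately have "d * (d - r) \<le> (d + 2) * (d - 1)"
      using pos by linarith
    then have "\<beta> \<le> 1"
      using pos by (simp add: \<beta>_def divide_le_eq)
    then show "0 \<le> d / r * (1 - \<beta>) - \<beta> / r + \<beta> / r"
      using pos by simp
    show "d / r = d / r * (1 - \<beta>) - \<beta> / r + \<beta> / r + \<beta> / r * real CARD('d)"
      using pos by (simp add: d_def[symmetric] field_simps)
    show "d / r * (1 - \<beta> + \<beta> * (trace LL / opnorm LL / d)) * opnorm LL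
      = (d / r * (1 - \<beta>) - \<beta> / r + \<beta> / r) * opnorm LL + \<beta> / r * trace LL"
      using pos L by (simp add: field_simps)
  qed
qed

subsection \<open>Gaussian matrices\<close>

text \<open>Orders up to four cover every power of a single entry that can occur in a product of
  four entries.\<close>

lemma normal_moments:
  assumes "0 < v"
  defines "moment \<equiv> \<lambda>k. \<integral>x. normal_density 0 (sqrt v) x * x ^ k \<partial>lborel"
  shows "moment 0 = 1" "moment 1 = 0" "moment 2 = v" "moment 3 = 0" "moment 4 = 3 * v\<^sup>2"
proof -
  show "moment 0 = 1" "moment 1 = 0"
    using assms(1) integral_normal_moment_even[of "sqrt v" 0 0] integral_normal_moment_odd[of "sqrt v" 0 0]
    by (simp_all add: moment_def)
  show "moment 2 = v"
    using assms(1) integral_normal_moment_even[of "sqrt v" 0 1]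
    by (simp add: moment_def power2_eq_square mult_ac)
  show "moment 3 = 0"
    using assms(1) integral_normal_moment_odd[of "sqrt v" 0 1]
    by (simp add: moment_def power3_eq_cube power2_eq_square mult_ac)
  show "moment 4 = 3 * v\<^sup>2"
    using assms(1) integral_normal_moment_even[of "sqrt v" 0 2]
    by (simp add: moment_def power_divide fact_numeral)
qed

locale iid_normal = prob_space M for M :: "'w measure" +
  fixes X :: "'i::finite \<Rightarrow> 'w \<Rightarrow> real" and v :: real
  assumes indep: "indep_vars (\<lambda>_. borel) X UNIV"
    and normal: "\<And>i. distributed M lborel (X i) (normal_density 0 (sqrt v))"
    and v_pos: "0 < v"
begin

definition "moment k = (\<integral>x. normal_density 0 (sqrt v) x * x ^ k \<partial>lborel)"

lemmas moment_simps [simp] = normal_moments[OF v_pos, folded moment_def]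

lemma moment_Suc_0 [simp]: "moment (Suc 0) = 0"
  using moment_simps(2) by simp

text \<open>Independence factorises the expectation. A product of entries is a monomial whose
  exponent \<open>e i\<close> counts the occurrences of the index i.\<close>

lemma monomial_moment:
  "has_bochner_integral M (\<lambda>w. \<Prod>i\<in>UNIV. X i w ^ e i) (\<Prod>i\<in>UNIV. moment (e i))"
proof -
  have int: "integrable M (\<lambda>w. X i w ^ k)" for i k
    using distributed_integrable[OF normal[of i], of "\<lambda>x. x ^ k"]
      integrable_normal_moment[of "sqrt v" 0 k] v_pos by simp
  have val: "(\<integral>w. X i w ^ k \<partial>M) = moment k" for i k
    using distributed_integral[OF normal[of i], of "\<lambda>x. x ^ k"] by (simp add: moment_def)
  have ind: "indep_vars (\<lambda>_. borel) (\<lambda>i w. X i w ^ e i) UNIV"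
    by (rule indep_vars_compose2[OF indep]) measurable
  show ?thesis
    using indep_vars_lebesgue_integral[OF finite ind int] indep_vars_integrable[OF finite ind int]
    by (simp add: has_bochner_integral_iff val)
qed

lemma moment_Suc_Suc_0 [simp]: "moment (Suc (Suc 0)) = v"
  using moment_simps(3) by (simp add: numeral_2_eq_2)

lemma prod_power_of_bool: "(\<Prod>i\<in>UNIV. X i w ^ of_bool (i = p)) = X p w"
proof -
  have "(\<Prod>i\<in>UNIV. X i w ^ of_bool (i = p)) = (\<Prod>i\<in>UNIV. if i = p then X i w else 1)"
    by (intro prod.cong) auto
  then show ?thesis by simp
qed

lemma second_moment: "has_bochner_integral M (\<lambda>w. X p w * X q w) (v * of_bool (p = q))"
proof -
  let ?e = "\<lambda>i. of_bool (i = p) + of_bool (i = q)"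
  have "(\<Prod>i\<in>UNIV. moment (?e i)) = v * of_bool (p = q)"
  proof (cases "p = q")
    case True
    then have "(\<Prod>i\<in>UNIV. moment (?e i)) = (\<Prod>i\<in>UNIV. if i = p then v else 1)"
      by (intro prod.cong) auto
    then show ?thesis using True by simp
  next
    case False
    then have "moment (?e p) = 0" by simp
    then have "(\<Prod>i\<in>UNIV. moment (?e i)) = 0" by (intro prod_zero) auto
    then show ?thesis using False by simp
  qed
  then show ?thesis
    using monomial_moment[of ?e] by (simp add: power_add prod.distrib prod_power_of_bool)
qed

text \<open>The expectation of X_p^2 X_q^2: the fourth moment 3 v^2 if the indices coincide, and v
  times v otherwise.\<close>

lemma prod_moments_pairs:
  fixes p q :: 'i
  shows "(\<Prod>i\<in>UNIV. moment (2 * of_bool (i = p) + 2 * of_bool (i = q)))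
    = v\<^sup>2 * (1 + 2 * of_bool (p = q))"
proof (cases "p = q")
  case True
  then have "(\<Prod>i\<in>UNIV. moment (2 * of_bool (i = p) + 2 * of_bool (i = q))) = (\<Prod>i\<in>UNIV. if i = p then 3 * v\<^sup>2 else 1)"
    by (intro prod.cong) auto
  also have "\<dots> = 3 * v\<^sup>2" by simp
  finally show ?thesis using True by simp
next
  case False
  then have "(\<Prod>i\<in>UNIV. moment (2 * of_bool (i = p) + 2 * of_bool (i = q)))
    = (\<Prod>i\<in>UNIV. (if i = p then v else 1) * (if i = q then v else 1))"
    by (intro prod.cong) auto
  then show ?thesis using False by (simp add: prod.distrib power2_eq_square)
qed

text \<open>The Wick formula, one summand per pairing of the four factors. Two pairings hold
  together only if all indices agree; then all three hold and give 3 v^2.\<close>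

lemma fourth_moment:
  "has_bochner_integral M (\<lambda>w. X p w * X q w * (X s w * X t w))
    (v\<^sup>2 * (of_bool (p = q \<and> s = t) + of_bool (p = s \<and> q = t) + of_bool (p = t \<and> q = s)))"
proof -
  let ?e = "\<lambda>i. of_bool (i = p) + of_bool (i = q) + (of_bool (i = s) + of_bool (i = t)) :: nat"
  let ?V = "v\<^sup>2 * (of_bool (p = q \<and> s = t) + of_bool (p = s \<and> q = t) + of_bool (p = t \<and> q = s))"
  have "(\<Prod>i\<in>UNIV. moment (?e i)) = ?V"
  proof -
    consider "p = q" "s = t" | "p = s" "q = t" | "p = t" "q = s"
      | "\<not> (p = q \<and> s = t)" "\<not> (p = s \<and> q = t)" "\<not> (p = t \<and> q = s)"
      by blast
    then show ?thesis
    proof cases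
      case 1
      have e: "?e i = 2 * of_bool (i = p) + 2 * of_bool (i = s)" for i
        using 1 by simp
      show ?thesis
        unfolding e prod_moments_pairs using 1 by (cases "p = s") simp_all
    next
      case 2
      have e: "?e i = 2 * of_bool (i = p) + 2 * of_bool (i = q)" for i
        using 2 by simp
      show ?thesis
        unfolding e prod_moments_pairs using 2 by (cases "p = q") simp_all
    next
      case 3
      have e: "?e i = 2 * of_bool (i = p) + 2 * of_bool (i = q)" for i
        using 3 by simp
      show ?thesis
        unfolding e prod_moments_pairs using 3 by (cases "p = q") simp_all
    next
      case 4
      \<comment> \<open>Without a pairing some index occurs an odd number of times; this one has
        exponent 1 or 3, so its moment vanishes.\<close>
      define j where "j = (if p = q then s else if p = s then q else if p = t then q else p)"
      have "?e j = 1 \<or> ?e j = 3"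
        using 4 by (auto simp: j_def)
      then have "moment (?e j) = 0" by (elim disjE) (simp_all only: moment_simps)
      then have "(\<Prod>i\<in>UNIV. moment (?e i)) = 0" by (intro prod_zero finite) blast
      moreover have "?V = 0"
        using 4 by (simp only: simp_thms of_bool_eq add_0_left mult_zero_right)
      ultimately show ?thesis by (rule trans[OF _ sym])
    qed
  qed
  moreover have "(\<Prod>i\<in>UNIV. X i w ^ ?e i) = X p w * X q w * (X s w * X t w)" for w
    by (simp only: power_add prod.distrib prod_power_of_bool)
  ultimately show ?thesis
    using monomial_moment[of ?e] by (simp only:)
qed

end

text \<open>Expand both entries as sums over columns a and b, with variance 1/r. The pairing inside
  each Gram entry allows all r^2 choices of (a, b) and contributes r^2 / r^2 = 1; the two cross
  pairings force a = b and contribute r / r^2 = 1/r each.\<close>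

lemma gaussian_gram_moments:
  fixes P :: "'w \<Rightarrow> real^'r^'d"
  assumes "prob_space M" and gauss: "iid_gaussian_entries M P (1 / real CARD('r))"
  defines "G \<equiv> \<lambda>w. P w ** transpose (P w)"
  shows "has_bochner_integral M (\<lambda>w. G w $ i $ k) (mat 1 $ i $ k)"
    and "has_bochner_integral M (\<lambda>w. G w $ i $ k * G w $ l $ j)
      (1 * of_bool (i = k \<and> l = j)
        + 1 / real CARD('r) * (of_bool (i = l \<and> k = j) + of_bool (i = j \<and> k = l)))"
proof -
  define X where "X = (\<lambda>(i, j) w. P w $ i $ j)"
  interpret iid_normal M X "1 / real CARD('r)"
    using assms unfolding iid_normal_def iid_normal_axioms_def iid_gaussian_entries_def X_def
    by (auto simp: split_beta)
  have G: "G w $ i $ k = (\<Sum>a\<in>UNIV. X (i, a) w * X (k, a) w)" for w i k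
    by (simp add: G_def X_def matrix_matrix_mult_def transpose_def)
  let ?v = "1 / real CARD('r)"
  have "has_bochner_integral M (\<lambda>w. G w $ i $ k) (\<Sum>a\<in>(UNIV::'r set). ?v * of_bool ((i, a) = (k, a)))"
    unfolding G by (intro has_bochner_integral_sum second_moment)
  then show "has_bochner_integral M (\<lambda>w. G w $ i $ k) (mat 1 $ i $ k)"
    by (simp add: mat_def of_bool_def split del: if_split)
  have collect: "(\<Sum>a\<in>(UNIV::'r set). \<Sum>b\<in>(UNIV::'r set). ?v\<^sup>2 * x + (if a = b then ?v\<^sup>2 * y else 0))
    = 1 * x + ?v * y" for x y :: real
    by (simp add: sum.distrib power2_eq_square distrib_left)
  have "has_bochner_integral M (\<lambda>w. G w $ i $ k * G w $ l $ j)
    (\<Sum>a\<in>(UNIV::'r set). \<Sum>b\<in>(UNIV::'r set). ?v\<^sup>2 * (of_bool ((i, a) = (k, a) \<and> (l, b) = (j, b))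
      + of_bool ((i, a) = (l, b) \<and> (k, a) = (j, b)) + of_bool ((i, a) = (j, b) \<and> (k, a) = (l, b))))"
    unfolding G sum_product by (intro has_bochner_integral_sum fourth_moment)
  also have "(\<Sum>a\<in>(UNIV::'r set). \<Sum>b\<in>(UNIV::'r set). ?v\<^sup>2 * (of_bool ((i, a) = (k, a) \<and> (l, b) = (j, b))
      + of_bool ((i, a) = (l, b) \<and> (k, a) = (j, b)) + of_bool ((i, a) = (j, b) \<and> (k, a) = (l, b))))
    = (\<Sum>a\<in>(UNIV::'r set). \<Sum>b\<in>(UNIV::'r set). ?v\<^sup>2 * of_bool (i = k \<and> l = j)
      + (if a = b then ?v\<^sup>2 * (of_bool (i = l \<and> k = j) + of_bool (i = j \<and> k = l)) else 0))"
    by (intro sum.cong refl) (auto simp: algebra_simps)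
  also have "\<dots> = 1 * of_bool (i = k \<and> l = j) + ?v * (of_bool (i = l \<and> k = j) + of_bool (i = j \<and> k = l))"
    unfolding collect ..
  finally show "has_bochner_integral M (\<lambda>w. G w $ i $ k * G w $ l $ j)
      (1 * of_bool (i = k \<and> l = j)
        + ?v * (of_bool (i = l \<and> k = j) + of_bool (i = j \<and> k = l)))" .
qed

text \<open>The isotropic case a = 1, b = 1/r: \<open>om\<close> is 1 + 1/r + d/r, and
  \<open>l\<close> has the trace-to-norm ratio of \<open>LL\<close> in place of d.\<close>

lemma gaussian_sketch_moment_conditions:
  fixes P :: "'w \<Rightarrow> real^'r^'d" and LL :: "real^'d^'d" and d r :: real
  assumes "prob_space M" and P: "iid_gaussian_entries M P (1 / real CARD('r))"
    and LL: "transpose LL = LL" and L: "0 < opnorm LL"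
  defines "d \<equiv> CARD('d)" and "r \<equiv> CARD('r)"
  shows "sketch_moment_conditions M P LL ((d + r + 1) / r) ((r + 1 + trace LL / opnorm LL) / r)"
proof -
  have pos: "0 < r" by (simp add: r_def)
  show ?thesis
    by (rule isotropic_sketch_moment_conditions[OF refl gaussian_gram_moments[OF assms(1) P] LL])
      (use pos L in \<open>auto simp: d_def[symmetric] r_def[symmetric] field_simps\<close>)
qed

subsection \<open>Coordinate sampling\<close>

text \<open>Removing B is a bijection onto the subsets of its complement of size k - |B|.\<close>

lemma card_supersets_of_card:
  fixes B :: "'a::finite set"
  assumes "card B \<le> k"
  shows "card {A. card A = k \<and> B \<subseteq> A} = (CARD('a) - card B) choose (k - card B)"
proof -
  have "bij_betw (\<lambda>A. A - B) {A. card A = k \<and> B \<subseteq> A} {A. A \<subseteq> - B \<and> card A = k - card B}"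
    by (rule bij_betw_byWitness[where f'="\<lambda>A. A \<union> B"])
       (use assms in \<open>auto simp: card_Diff_subset card_Un_disjoint disjoint_eq_subset_Compl\<close>)
  then show ?thesis
    by (simp add: bij_betw_same_card n_subsets card_Diff_subset Compl_eq_Diff_UNIV)
qed

context
  fixes k :: nat
  assumes k: "1 \<le> k" "k \<le> CARD('a::finite)"
begin

abbreviation "unif \<equiv> pmf_of_set {A :: 'a set. card A = k}"

lemma expectation_supset_unif:
  fixes B :: "'a set"
  shows "measure_pmf.expectation unif (\<lambda>A. of_bool (B \<subseteq> A))
    = card {A. card A = k \<and> B \<subseteq> A} / (CARD('a) choose k)"
proof -
  have card: "card {A :: 'a set. card A = k} = CARD('a) choose k"
    using n_subsets[of "UNIV :: 'a set" k] by simp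
  then have "{A :: 'a set. card A = k} \<noteq> {}"
    using k by (metis binomial_eq_0_iff card.empty not_le)
  then show ?thesis
    by (simp add: integral_pmf_of_set card sum_of_bool_eq Collect_conj_eq)
qed

text \<open>The inclusion probability C(n-1, k-1) / C(n, k), simplified by the absorption identity k
  C(n, k) = n C(n-1, k-1).\<close>

lemma expectation_mem_unif:
  "measure_pmf.expectation unif (\<lambda>A. of_bool (i \<in> A)) = k / CARD('a)"
proof -
  have "card {A :: 'a set. card A = k \<and> {i} \<subseteq> A} = (CARD('a) - 1) choose (k - 1)"
    using k by (subst card_supersets_of_card) auto
  moreover have "real k * (CARD('a) choose k) = CARD('a) * ((CARD('a) - 1) choose (k - 1))"
    using times_binomial_minus1_eq[of k "CARD('a)"] k by (metis of_nat_mult Suc_le_eq One_nat_def)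
  moreover have "0 < CARD('a) choose k"
    using k by simp
  ultimately show ?thesis
    using expectation_supset_unif[of "{i}"] k by (simp add: frac_eq_eq mult_ac)
qed

text \<open>The joint inclusion probability C(n-2, k-2) / C(n, k), by applying the absorption
  identity twice.\<close>

lemma expectation_mem_mem_unif:
  assumes "i \<noteq> j"
  shows "measure_pmf.expectation unif (\<lambda>A. of_bool (i \<in> A \<and> j \<in> A))
    = k * (real k - 1) / (CARD('a) * (real CARD('a) - 1))"
proof -
  have two: "2 \<le> CARD('a)"
    using card_mono[of UNIV "{i, j}"] assms by simp
  have eq: "measure_pmf.expectation unif (\<lambda>A. of_bool (i \<in> A \<and> j \<in> A))
    = card {A. card A = k \<and> {i, j} \<subseteq> A} / (CARD('a) choose k)"
    using expectation_supset_unif[of "{i, j}"] by simp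
  show ?thesis
  \<comment> \<open>For k = 1 truncated subtraction would turn the binomial coefficient into 1,
    although no singleton contains both indices.\<close>
  proof (cases "k = 1")
    case True
    have "{A :: 'a set. card A = k \<and> {i, j} \<subseteq> A} = {}"
      using assms True by (auto simp: card_1_singleton_iff)
    then show ?thesis unfolding eq using True by simp
  next
    case False
    then have k2: "2 \<le> k" using k by simp
    let ?N = "real (CARD('a) choose k)" and ?N1 = "real ((CARD('a) - 1) choose (k - 1))"
      and ?N2 = "real ((CARD('a) - 2) choose (k - 2))"
    have 0: "card {A :: 'a set. card A = k \<and> {i, j} \<subseteq> A} = (CARD('a) - 2) choose (k - 2)"
      using k2 assms by (subst card_supersets_of_card) (auto simp: numeral_2_eq_2)
    have 1: "real k * ?N = CARD('a) * ?N1"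
      using times_binomial_minus1_eq[of k "CARD('a)"] k unfolding of_nat_mult[symmetric] by simp
    have "(k - 1) * ((CARD('a) - 1) choose (k - 1)) = (CARD('a) - 1) * ((CARD('a) - 2) choose (k - 2))"
      using times_binomial_minus1_eq[of "k - 1" "CARD('a) - 1"] k2 by (simp add: numeral_2_eq_2)
    then have "real (k - 1) * ?N1 = real (CARD('a) - 1) * ?N2"
      unfolding of_nat_mult[symmetric] by simp
    then have 2: "(real k - 1) * ?N1 = (real CARD('a) - 1) * ?N2"
      using k2 two by (simp add: of_nat_diff)
    have "k * (real k - 1) * ?N = CARD('a) * ((real k - 1) * ?N1)"
      using 1 by (simp add: mult_ac)
    then have "k * (real k - 1) * ?N = CARD('a) * (real CARD('a) - 1) * ?N2"
      unfolding 2 by simp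
    moreover have "0 < CARD('a) choose k"
      using k by simp
    ultimately show ?thesis
      unfolding eq 0 using two by (simp add: frac_eq_eq mult_ac)
  qed
qed

end

text \<open>Only the law of the sampled set is prescribed, so \<open>F\<close> has to factor through
  the range. It may do so on injective selections alone, because the sampled indices are distinct
  almost everywhere.\<close>

lemma uniform_distinct_sample_has_bochner_integral:
  fixes J :: "'w \<Rightarrow> 'r::finite \<Rightarrow> 'd::finite" and F :: "('r \<Rightarrow> 'd) \<Rightarrow> real"
  assumes J: "uniform_distinct_sample M J"
    and F: "\<And>c. inj c \<Longrightarrow> F c = H (range c)"
  shows "has_bochner_integral M (\<lambda>w. F (J w))
    (measure_pmf.expectation (pmf_of_set {A. card A = CARD('r)}) H)"
proof -
  let ?D = "distr M (count_space UNIV) (\<lambda>w. range (J w))"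
  have [measurable]: "J \<in> measurable M (count_space UNIV)"
    and inj: "AE w in M. inj (J w)"
    and D: "?D = measure_pmf (pmf_of_set {A. card A = CARD('r)})"
    using J unfolding uniform_distinct_sample_def by blast+
  have R [measurable]: "(\<lambda>w. range (J w)) \<in> measurable M (count_space UNIV)"
    by measurable
  have Hm: "H \<in> borel_measurable (count_space UNIV)"
    by simp
  have "integrable ?D H"
    unfolding D by (rule integrable_measure_pmf_finite) (rule finite)
  then have "integrable M (\<lambda>w. H (range (J w)))"
    unfolding integrable_distr_eq[OF R Hm] .
  moreover have "(\<integral>w. H (range (J w)) \<partial>M) = measure_pmf.expectation (pmf_of_set {A. card A = CARD('r)}) H"
    unfolding D[symmetric] by (rule integral_distr[OF R Hm, symmetric])
  ultimately have "has_bochner_integral M (\<lambda>w. H (range (J w)))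
      (measure_pmf.expectation (pmf_of_set {A. card A = CARD('r)}) H)"
    by (simp add: has_bochner_integral_iff)
  moreover have "AE w in M. F (J w) = H (range (J w))"
    using inj by eventually_elim (rule F)
  ultimately show ?thesis
    by (subst has_bochner_integral_cong_AE[where g="\<lambda>w. H (range (J w))"]) (simp_all, measurable)
qed

text \<open>E[G A G] is d / r times a convex combination of A and diag(A). Bounding each of the two
  by its own norm produces \<open>l\<close>.\<close>

lemma coordinate_sketch_moment_conditions:
  fixes J :: "'w \<Rightarrow> 'r::finite \<Rightarrow> 'd::finite" and LL :: "real^'d^'d" and d r :: real
  assumes J: "uniform_distinct_sample M J" and d2: "2 \<le> CARD('d)" and rd: "CARD('r) \<le> CARD('d)"
    and LL: "transpose LL = LL" and L: "0 < opnorm LL"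
  defines "d \<equiv> CARD('d)" and "r \<equiv> CARD('r)"
  shows "sketch_moment_conditions M (\<lambda>w. sqrt (d / r) *\<^sub>R select_columns (J w) (mat 1 :: real^'d^'d)) LL (d / r)
    (d / r * ((r - 1) / (d - 1) + (d - r) / (d - 1) * (opnorm (diag_part LL) / opnorm LL)))"
proof -
  have r1: "1 \<le> CARD('r)" by (simp add: Suc_le_eq)
  have pos: "1 \<le> r" "2 \<le> d" "r \<le> d" using d2 rd r1 by (simp_all add: r_def d_def)
  define P where "P = (\<lambda>w. sqrt (d / r) *\<^sub>R select_columns (J w) (mat 1 :: real^'d^'d))"
  have G: "(P w ** transpose (P w)) $ i $ k = d / r * col_gram (J w) (mat 1) i k" for w i k
    unfolding P_def gram_scaleR_select_columns using pos by simp
  \<comment> \<open>For distinct columns of I the Gram matrix is diagonal, with the indicator of the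
    sampled set on the diagonal.\<close>
  have gram: "col_gram c (mat 1) i k = of_bool (i = k \<and> i \<in> range c)" if "inj c" for c :: "'r \<Rightarrow> 'd" and i k
  proof -
    have "col_gram c (mat 1) i k = (\<Sum>a\<in>UNIV. of_bool (i = k \<and> c a = i))"
      unfolding col_gram_def by (intro sum.cong) (auto simp: mat_def)
    also have "\<dots> = card {a. i = k \<and> c a = i}"
      by (simp add: sum_of_bool_eq)
    also have "{a. i = k \<and> c a = i} = (if i = k \<and> i \<in> range c then {inv c i} else {})"
      using that by (auto simp: inv_f_f inj_eq[OF that])
    finally show ?thesis by auto
  qed
  \<comment> \<open>Entry (i, j) of E[G A G] is (d / r)^2 \<open>p i j\<close> A_ij. This factor is
    d / r on the diagonal and (d / r)(r - 1)/(d - 1) off it, and the \<open>diag_part\<close> term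
    supplies the difference.\<close>
  define T where "T A = (d / r) *\<^sub>R (((r - 1) / (d - 1)) *\<^sub>R A + ((d - r) / (d - 1)) *\<^sub>R diag_part A)"
    for A :: "real^'d^'d"
  define p where "p i l = (if i = l then r / d else r * (r - 1) / (d * (d - 1)))" for i l :: 'd
  have p: "measure_pmf.expectation (pmf_of_set {A. card A = CARD('r)}) (\<lambda>A. of_bool (i \<in> A \<and> l \<in> A)) = p i l"
    for i l :: 'd
    using expectation_mem_unif[OF r1 rd, of i] expectation_mem_mem_unif[OF r1 rd, of i l]
    by (cases "i = l") (simp_all add: p_def d_def r_def)
  have H2: "has_bochner_integral M
      (\<lambda>w. (P w ** transpose (P w)) $ i $ k * (P w ** transpose (P w)) $ l $ j)
      ((d / r)\<^sup>2 * (of_bool (i = k \<and> l = j) * p i l))" for i j k l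
  proof -
    have "has_bochner_integral M (\<lambda>w. col_gram (J w) (mat 1) i k * col_gram (J w) (mat 1) l j)
      (measure_pmf.expectation (pmf_of_set {A. card A = CARD('r)})
        (\<lambda>A. of_bool (i = k \<and> l = j) * of_bool (i \<in> A \<and> l \<in> A)))"
      by (rule uniform_distinct_sample_has_bochner_integral[OF J]) (auto simp: gram)
    then have "has_bochner_integral M (\<lambda>w. col_gram (J w) (mat 1) i k * col_gram (J w) (mat 1) l j)
      (of_bool (i = k \<and> l = j) * p i l)"
      by (simp only: Bochner_Integration.integral_mult_right_zero p)
    then have "has_bochner_integral M (\<lambda>w. (d / r)\<^sup>2 * (col_gram (J w) (mat 1) i k * col_gram (J w) (mat 1) l j))
      ((d / r)\<^sup>2 * (of_bool (i = k \<and> l = j) * p i l))"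
      by (rule has_bochner_integral_mult_right)
    then show ?thesis
      by (simp add: G power2_eq_square mult_ac)
  qed
  show ?thesis
    unfolding P_def[symmetric]
  proof (rule sketch_moment_conditionsI[OF refl, where T=T])
    fix i k
    have "has_bochner_integral M (\<lambda>w. col_gram (J w) (mat 1) i k)
      (measure_pmf.expectation (pmf_of_set {A. card A = CARD('r)})
        (\<lambda>A. of_bool (i = k) * of_bool (i \<in> A \<and> i \<in> A)))"
      by (rule uniform_distinct_sample_has_bochner_integral[OF J]) (auto simp: gram)
    then have "has_bochner_integral M (\<lambda>w. col_gram (J w) (mat 1) i k) (of_bool (i = k) * p i i)"
      by (simp only: Bochner_Integration.integral_mult_right_zero p)
    then have "has_bochner_integral M (\<lambda>w. d / r * col_gram (J w) (mat 1) i k)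
      (d / r * (of_bool (i = k) * p i i))"
      by (rule has_bochner_integral_mult_right)
    also have "d / r * (of_bool (i = k) * p i i) = mat 1 $ i $ k"
      using pos by (simp add: p_def mat_def)
    finally show "has_bochner_integral M (\<lambda>w. (P w ** transpose (P w)) $ i $ k) (mat 1 $ i $ k)"
      unfolding G .
  next
    show "integrable M (\<lambda>w. (P w ** transpose (P w)) $ i $ k * (P w ** transpose (P w)) $ l $ j)" for i j k l
      using H2 by (rule integrable.intros)
  next
    fix A :: "real^'d^'d" and i j
    have "(\<Sum>l\<in>UNIV. \<Sum>k\<in>UNIV. A $ k $ l * ((d / r)\<^sup>2 * (of_bool (i = k \<and> l = j) * p i l)))
      = (\<Sum>l\<in>UNIV. \<Sum>k\<in>UNIV. if k = i then (if l = j then A $ k $ l * ((d / r)\<^sup>2 * p i l) else 0) else 0)"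
      by (intro sum.cong refl) auto
    also have "\<dots> = (d / r)\<^sup>2 * p i j * A $ i $ j"
      by simp
    also have "\<dots> = T A $ i $ j"
    proof (cases "i = j")
      case True
      have "(r - 1) / (d - 1) + (d - r) / (d - 1) = 1"
        using pos by (simp add: add_divide_distrib[symmetric])
      then have "((r - 1) / (d - 1)) * y + (d - r) / (d - 1) * y = y" for y
        by (metis distrib_right mult_1)
      then show ?thesis
        using True pos by (simp add: T_def p_def diag_part_def power2_eq_square)
    next
      case False
      then show ?thesis
        using pos by (simp add: T_def p_def diag_part_def power2_eq_square)
    qed
    finally show "(\<Sum>l\<in>UNIV. \<Sum>k\<in>UNIV. A $ k $ l
        * (\<integral>w. (P w ** transpose (P w)) $ i $ k * (P w ** transpose (P w)) $ l $ j \<partial>M)) = T A $ i $ j"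
      unfolding has_bochner_integral_integral_eq[OF H2] .
  next
    show "transpose LL = LL" by (rule LL)
  next
    have "diag_part (mat 1) = (mat 1 :: real^'d^'d)"
      by (simp add: diag_part_def mat_def vec_eq_iff)
    moreover have "(r - 1) / (d - 1) + (d - r) / (d - 1) = 1"
      using pos by (simp add: add_divide_distrib[symmetric])
    ultimately have T1: "T (mat 1) = (d / r) *\<^sub>R mat 1"
      by (simp add: T_def scaleR_add_left[symmetric])
    show "T (mat 1) \<preceq>\<^sub>L (d / r) *\<^sub>R mat 1"
      unfolding T1 using scaleR_add_mat_loewner_le[of "mat 1 :: real^'d^'d" 0 "d / r"]
      by (simp add: transpose_mat)
  next
    have "transpose (T LL) = T LL"
      using transpose_eq_selfD[OF LL] by (simp add: T_def transpose_def diag_part_def vec_eq_iff)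
    moreover have "x \<bullet> (T LL *v x)
      \<le> d / r * ((r - 1) / (d - 1) + (d - r) / (d - 1) * (opnorm (diag_part LL) / opnorm LL)) * opnorm LL * (x \<bullet> x)" for x
    proof -
      have "x \<bullet> (T LL *v x) = d / r * ((r - 1) / (d - 1) * (x \<bullet> (LL *v x))
          + (d - r) / (d - 1) * (x \<bullet> (diag_part LL *v x)))"
        by (simp add: T_def scaleR_matrix_vector_assoc[symmetric] matrix_vector_mult_add_rdistrib inner_add_right)
      also have "\<dots> \<le> d / r * ((r - 1) / (d - 1) * (opnorm LL * (x \<bullet> x))
          + (d - r) / (d - 1) * (opnorm (diag_part LL) * (x \<bullet> x)))"
        using pos by (intro mult_left_mono add_mono inner_matrix_vector_le_opnorm) auto
      also have "\<dots> = d / r * ((r - 1) / (d - 1) + (d - r) / (d - 1) * (opnorm (diag_part LL) / opnorm LL))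
          * opnorm LL * (x \<bullet> x)"
        using L by (simp add: distrib_left distrib_right)
      finally show ?thesis .
    qed
    ultimately show "T LL \<preceq>\<^sub>L (d / r * ((r - 1) / (d - 1) + (d - r) / (d - 1)
        * (opnorm (diag_part LL) / opnorm LL)) * opnorm LL) *\<^sub>R mat 1"
      unfolding loewner_le_scaleR_mat1 by blast
  qed
qed

text \<open>The first r columns are modelled by an injection \<open>first_cols\<close> into the
  index type, which carries no order. The laws of the three sketches are quantified separately over
  the same probability space.\<close>

theorem proposition5p1:
  fixes LL :: "real^'d^'d"
    and first_cols :: "'r::finite \<Rightarrow> 'd"
    and M :: "'w measure"
    and d r :: nat
    and L r_eff \<delta>_diag \<beta> :: real
  assumes dim_d: "CARD('d) = d" and dim_r: "CARD('r) = r"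
    and d_ge: "2 \<le> d" and r_ge: "1 \<le> r" and r_le: "r \<le> d"
    and LL_sym: "transpose LL = LL" and LL_psd: "0 \<preceq>\<^sub>L LL"
    and L_eq: "L = opnorm LL" and L_pos: "0 < L"
    and r_eff_eq: "r_eff = trace LL / L"
    and \<delta>_diag_eq: "\<delta>_diag = opnorm (diag_part LL) / L"
    and \<beta>_eq: "\<beta> = real d * (real d - real r) / ((real d + 2) * (real d - 1))"
    and prob: "prob_space M"
    and first_cols: "inj first_cols"
  shows
    "(\<forall>Q :: 'w \<Rightarrow> real^'d^'d. haar_distributed M Q \<longrightarrow>
       (\<forall>\<omega> l. \<omega> = real d / real r \<longrightarrow>
          l = real d / real r * (1 - \<beta> + \<beta> * (r_eff / real d)) \<longrightarrow>
          sketch_moment_conditions M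
            (\<lambda>w. sqrt (real d / real r) *\<^sub>R select_columns first_cols (Q w)) LL \<omega> l \<and>
          sqrt (\<omega> * l * (real r)^2) = real d * sqrt (1 - \<beta> + \<beta> * r_eff / real d))) \<and>
     (\<forall>J :: 'w \<Rightarrow> 'r \<Rightarrow> 'd. uniform_distinct_sample M J \<longrightarrow>
       (\<forall>\<omega> l. \<omega> = real d / real r \<longrightarrow>
          l = real d / real r * ((real r - 1) / (real d - 1)
                + (real d - real r) / (real d - 1) * \<delta>_diag) \<longrightarrow>
          sketch_moment_conditions M
            (\<lambda>w. sqrt (real d / real r) *\<^sub>R select_columns (J w) (mat 1 :: real^'d^'d)) LL \<omega> l \<and>
          sqrt (\<omega> * l * (real r)^2) = real d * sqrt ((real r - 1) / (real d - 1)
                + (real d - real r) / (real d - 1) * \<delta>_diag))) \<and>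
     (\<forall>P :: 'w \<Rightarrow> real^'r^'d. iid_gaussian_entries M P (1 / real r) \<longrightarrow>
       (\<forall>\<omega> l. \<omega> = (real d + real r + 1) / real r \<longrightarrow>
          l = (real r + 1 + r_eff) / real r \<longrightarrow>
          sketch_moment_conditions M P LL \<omega> l \<and>
          sqrt (\<omega> * l * (real r)^2) = sqrt ((real d + real r + 1) * (real r + 1 + r_eff)))) \<and>
     1 \<le> r_eff \<and> r_eff \<le> real d \<and>
     1 / real d \<le> \<delta>_diag \<and> \<delta>_diag \<le> 1 \<and>
     r_eff / real d \<le> \<delta>_diag"
proof -
  have d2: "2 \<le> CARD('d)" and rd: "CARD('r) \<le> CARD('d)"
    using dim_d dim_r d_ge r_le by simp_all
  have pos: "2 \<le> real d" "1 \<le> real r" "real r \<le> real d"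
    using d_ge r_ge r_le by simp_all
  have psd: "pos_semidef LL"
    using LL_psd by (simp add: loewner_le_def)
  note L_pos' = L_pos[unfolded L_eq]
  \<comment> \<open>Haar and coordinate sketches share \<open>\<omega>\<close> = d / r, and
    \<open>l\<close> also carries the factor d / r, so both square roots reduce to this
    identity.\<close>
  have scale: "sqrt (real d / real r * (real d / real r * y) * (real r)\<^sup>2) = real d * sqrt y" for y
    using pos by (simp add: real_sqrt_mult real_sqrt_divide power2_eq_square)
  have haar: "sketch_moment_conditions M
      (\<lambda>w. sqrt (real d / real r) *\<^sub>R select_columns first_cols (Q w)) LL (real d / real r)
      (real d / real r * (1 - \<beta> + \<beta> * (r_eff / real d)))"
    if "haar_distributed M Q" for Q :: "'w \<Rightarrow> real^'d^'d"
    using haar_sketch_moment_conditions[OF that first_cols d2 LL_sym L_pos']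
    by (simp only: dim_d dim_r \<beta>_eq r_eff_eq L_eq)
  have coordinate: "sketch_moment_conditions M
      (\<lambda>w. sqrt (real d / real r) *\<^sub>R select_columns (J w) (mat 1 :: real^'d^'d)) LL (real d / real r)
      (real d / real r * ((real r - 1) / (real d - 1) + (real d - real r) / (real d - 1) * \<delta>_diag))"
    if "uniform_distinct_sample M J" for J :: "'w \<Rightarrow> 'r \<Rightarrow> 'd"
    using coordinate_sketch_moment_conditions[OF that d2 rd LL_sym L_pos']
    by (simp only: dim_d dim_r \<delta>_diag_eq L_eq)
  have gaussian: "sketch_moment_conditions M P LL ((real d + real r + 1) / real r)
      ((real r + 1 + r_eff) / real r)"
    if "iid_gaussian_entries M P (1 / real r)" for P :: "'w \<Rightarrow> real^'r^'d"
    using gaussian_sketch_moment_conditions[OF prob that[folded dim_r] LL_sym L_pos']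
    by (simp only: dim_d dim_r r_eff_eq L_eq)
  have gaussian_scale: "(real d + real r + 1) / real r * ((real r + 1 + r_eff) / real r) * (real r)\<^sup>2
      = (real d + real r + 1) * (real r + 1 + r_eff)"
    using pos by (simp add: power2_eq_square)
  \<comment> \<open>These three inequalities and the two obtained by chaining them become the five
    bounds on \<open>r_eff\<close> and \<open>\<delta>_diag\<close> after division by L and, where
    needed, by d.\<close>
  have "L \<le> trace LL" "trace LL \<le> d * opnorm (diag_part LL)" "opnorm (diag_part LL) \<le> L"
    using opnorm_le_trace[OF psd] trace_le_opnorm_diag_part[of LL] opnorm_diag_part_le[of LL] dim_d
    by (simp_all add: L_eq)
  moreover from this have "trace LL \<le> d * L" "L \<le> d * opnorm (diag_part LL)"
    using mult_left_mono[of "opnorm (diag_part LL)" L "real d"] by simp_all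
  ultimately have "1 \<le> r_eff" "r_eff \<le> real d" "1 / real d \<le> \<delta>_diag" "\<delta>_diag \<le> 1" "r_eff / real d \<le> \<delta>_diag"
    using L_pos pos unfolding r_eff_eq \<delta>_diag_eq by (simp_all add: field_simps)
  \<comment> \<open>The statement brackets this product differently in \<open>l\<close> and under
    the square root.\<close>
  moreover have "\<beta> * r_eff / real d = \<beta> * (r_eff / real d)"
    by simp
  ultimately show ?thesis
    using haar coordinate gaussian by (auto simp only: scale gaussian_scale)
qed

end
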